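(* Let $N\geq 1$, $p>1$, let $L(x,\nabla)$ be a linear differential operator on $\mathbb{R}^N$ of order $m$, and let $f\in L^\infty_{\mathrm{loc}}(\mathbb{R}^N)$ with $f(x)>0$ a.e. Assume there exists $g$ with $g(x)>0$ a.e. such that, setting $D=gL$, the formal adjoint $D^*$ is a differential operator with $L^\infty_{\mathrm{loc}}$ coefficients and no zero order term, i.e. \[ D^*(x,\nabla)=\sum_{1\leq|\alpha|\leq m}a_\alpha(x)\partial_x^\alpha,\qquad a_\alpha\in L^\infty_{\mathrm{loc}}(\mathbb{R}^N). \] Let $u\in L^1_{\mathrm{loc}}(\mathbb{R}^N)$ with $fg|u|^p\in L^1_{\mathrm{loc}}(\mathbb{R}^N)$ be a global $g$-solution of $Lu=f|u|^p$, i.e. \[ \int_{\mathbb{R}^N}f(x)g(x)|u(x)|^p\phi(x)\,dx=\int_{\mathbb{R}^N}u(x)\,D^*(x,\nabla)\phi(x)\,dx\qquad\text{for all }\phi\in\mathcal{C}^\infty_c(\mathbb{R}^N). \] Suppose there exist strictly increasing continuous functions $F_i:(0,\infty)\to(0,\infty)$, $i=1,\dots,N$, with $F_i(R)\to\infty$ as $R\to\infty$, such that \[ \limsup_{R\to\infty}H_\alpha(R)\,G_\alpha(R)^{1/p'}<\infty\qquad\text{for every }1\leq|\alpha|\leq m, \] where $p'=p/(p-1)$, \[ H_\alpha(R)=\prod_{i=1}^NF_i(R)^{-\alpha_i},\qquad G_\alpha(R)=\int_{Q_R^{(\alpha)}}|a_\alpha(x)|^{p'}\,(g(x)f(x))^{-(p'-1)}\,dx\in[0,\infty],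 \] and $Q_R^{(\alpha)}=\{x\in\mathbb{R}^N:\ |x_i|\leq F_i(R)\ \forall i,\ \ |x_i|\geq F_i(R)/2\text{ for every }i\text{ with }\alpha_i\neq0\}$. Then $u(x)=0$ a.e.
   Context: The formal adjoint $D^*$ of a differential operator $D$ is defined by $\int vDu\,dx=\int u D^*v\,dx$ for all $u,v\in\mathcal{C}^\infty_c(\mathbb{R}^N)$. *)

theory Defs
  imports "HOL-Analysis.Analysis"
begin

definition pderiv_dir :: "'n::finite \<Rightarrow> (real^'n \<Rightarrow> real) \<Rightarrow> real^'n \<Rightarrow> real" where
  "pderiv_dir i \<phi> x = deriv (\<lambda>t. \<phi> (x + t *\<^sub>R axis i 1)) 0"

fun pderiv_list :: "'n::finite list \<Rightarrow> (real^'n \<Rightarrow> real) \<Rightarrow> real^'n \<Rightarrow> real" where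
  "pderiv_list [] \<phi> = \<phi>"
| "pderiv_list (i # is) \<phi> = pderiv_dir i (pderiv_list is \<phi>)"

definition mi_order :: "('n::finite \<Rightarrow> nat) \<Rightarrow> nat" where
  "mi_order \<alpha> = (\<Sum>i\<in>UNIV. \<alpha> i)"

(* \<partial>^alpha: differentiate alpha i times in direction i (order irrelevant for smooth phi) *)
definition pderiv_mi :: "('n::finite \<Rightarrow> nat) \<Rightarrow> (real^'n \<Rightarrow> real) \<Rightarrow> real^'n \<Rightarrow> real" where
  "pderiv_mi \<alpha> \<phi> = pderiv_list (SOME is. \<forall>i. count_list is i = \<alpha> i) \<phi>"

definition smooth_fun :: "(real^'n::finite \<Rightarrow> real) \<Rightarrow> bool" where
  "smooth_fun \<phi> \<longleftrightarrow> (\<forall>is. pderiv_list is \<phi> differentiable_on UNIV)"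

definition test_fun :: "(real^'n::finite \<Rightarrow> real) \<Rightarrow> bool" where
  "test_fun \<phi> \<longleftrightarrow> smooth_fun \<phi> \<and> (\<exists>K. compact K \<and> (\<forall>x. x \<notin> K \<longrightarrow> \<phi> x = 0))"

definition L1_loc :: "(real^'n::finite \<Rightarrow> real) \<Rightarrow> bool" where
  "L1_loc u \<longleftrightarrow> u \<in> borel_measurable lebesgue \<and>
     (\<forall>K. compact K \<longrightarrow> set_integrable lebesgue K u)"

definition Linf_loc :: "(real^'n::finite \<Rightarrow> real) \<Rightarrow> bool" where
  "Linf_loc u \<longleftrightarrow> u \<in> borel_measurable lebesgue \<and>
     (\<forall>K. compact K \<longrightarrow> (\<exists>C. AE x in lebesgue. x \<in> K \<longrightarrow> \<bar>u x\<bar> \<le> C))"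

(* power of an element of [0,\<infinity>] with positive real exponent, \<infinity>^r = \<infinity> *)
definition enn_powr :: "ennreal \<Rightarrow> real \<Rightarrow> ennreal" where
  "enn_powr G r = (if G = \<infinity> then \<infinity> else ennreal (enn2real G powr r))"

definition Q_set :: "('n::finite \<Rightarrow> real \<Rightarrow> real) \<Rightarrow> ('n \<Rightarrow> nat) \<Rightarrow> real \<Rightarrow> (real^'n) set" where
  "Q_set F \<alpha> R = {x. \<forall>i. \<bar>x $ i\<bar> \<le> F i R \<and> (\<alpha> i \<noteq> 0 \<longrightarrow> \<bar>x $ i\<bar> \<ge> F i R / 2)}"

definition H_fun :: "('n::finite \<Rightarrow> real \<Rightarrow> real) \<Rightarrow> ('n \<Rightarrow> nat) \<Rightarrow> real \<Rightarrow> real" where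
  "H_fun F \<alpha> R = (\<Prod>i\<in>UNIV. F i R powr (- real (\<alpha> i)))"

definition G_fun :: "('n::finite \<Rightarrow> real \<Rightarrow> real) \<Rightarrow> real \<Rightarrow> (real^'n \<Rightarrow> real) \<Rightarrow> (real^'n \<Rightarrow> real)
    \<Rightarrow> (real^'n \<Rightarrow> real) \<Rightarrow> ('n \<Rightarrow> nat) \<Rightarrow> real \<Rightarrow> ennreal" where
  "G_fun F p' a g f \<alpha> R = (\<integral>\<^sup>+ x \<in> Q_set F \<alpha> R.
      ennreal (\<bar>a x\<bar> powr p' * (g x * f x) powr (- (p' - 1))) \<partial>lebesgue)"

end

theory Submission
  imports Defs
begin

text \<open>
  Let \<open>v = f g |u|\<^sup>p\<close> be the source of the equation. Test it with
  \<open>\<phi>\<^sub>R(x) = \<Prod>\<^sub>i \<eta>(x\<^sub>i / F\<^sub>i(R))\<close>, where \<open>\<eta>\<close> is a high power of a smooth plateau function.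
  Taking a power gives \<open>|\<eta>\<^sup>(\<^sup>j\<^sup>)| \<le> C \<eta>\<^sup>1\<^sup>/\<^sup>p\<close> for \<open>j \<le> m\<close>, hence \<open>|\<partial>\<^sup>\<alpha>\<phi>\<^sub>R| \<le> C H\<^sub>\<alpha>(R) \<phi>\<^sub>R\<^sup>1\<^sup>/\<^sup>p\<close>, with
  support in the set \<open>Q\<^sub>\<alpha>\<close> belonging to \<open>\<alpha>\<close> and \<open>R\<close>. By Hoelder's inequality and the growth
  hypothesis, \<open>J(R) = \<integral> v \<phi>\<^sub>R\<close> is at most \<open>K \<Sum>\<^sub>\<alpha> J\<^sub>\<alpha>(R)\<^sup>1\<^sup>/\<^sup>p\<close> for large \<open>R\<close>, where \<open>J\<^sub>\<alpha>(R) \<le> J(R)\<close> is the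
  integral of \<open>v \<phi>\<^sub>R\<close> over \<open>Q\<^sub>\<alpha>\<close>. As \<open>1/p < 1\<close>, this bounds \<open>J\<close>, so \<open>v\<close> is integrable. Since every
  \<open>\<alpha>\<close> is nonzero, the sets \<open>Q\<^sub>\<alpha>\<close> escape to infinity; hence \<open>J\<^sub>\<alpha>(R) \<longrightarrow> 0\<close> and \<open>\<integral> v = 0\<close>.
\<close>

subsection \<open>Infinitely differentiable functions of one variable\<close>

primrec k_times_differentiable :: "nat \<Rightarrow> ('a::real_normed_field \<Rightarrow> 'a) \<Rightarrow> bool" where
  "k_times_differentiable 0 h \<longleftrightarrow> True"
| "k_times_differentiable (Suc k) h \<longleftrightarrow>
     (\<exists>h'. (\<forall>x. (h has_field_derivative h' x) (at x)) \<and> k_times_differentiable k h')"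

definition infinitely_differentiable :: "('a::real_normed_field \<Rightarrow> 'a) \<Rightarrow> bool" where
  "infinitely_differentiable h \<longleftrightarrow> (\<forall>k. k_times_differentiable k h)"

lemma k_times_differentiable_SucD: "k_times_differentiable (Suc k) h \<Longrightarrow> k_times_differentiable k h"
proof (induction k arbitrary: h)
  case (Suc k)
  then obtain h' where
    "\<forall>x. (h has_field_derivative h' x) (at x)" "k_times_differentiable (Suc k) h'"
    by (auto simp only: k_times_differentiable.simps)
  with Suc.IH show ?case by auto
qed simp

lemma k_times_differentiable_const: "k_times_differentiable k (\<lambda>_. c)"
proof (induction k arbitrary: c)
  case (Suc k)
  show ?case using Suc[of 0] by (auto intro!: exI[of _ "\<lambda>_. 0"])
qed simp

lemma k_times_differentiable_ident: "k_times_differentiable k (\<lambda>x. x)"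
  by (cases k) (auto intro!: exI[of _ "\<lambda>_. 1"] k_times_differentiable_const)

lemma k_times_differentiable_add:
  "k_times_differentiable k f \<Longrightarrow> k_times_differentiable k g \<Longrightarrow>
    k_times_differentiable k (\<lambda>x. f x + g x)"
proof (induction k arbitrary: f g)
  case (Suc k)
  then obtain f' g' where "\<forall>x. (f has_field_derivative f' x) (at x)" "k_times_differentiable k f'"
     "\<forall>x. (g has_field_derivative g' x) (at x)" "k_times_differentiable k g'" by auto
  with Suc.IH[of f' g'] show ?case
    by (auto intro!: exI[of _ "\<lambda>x. f' x + g' x"] derivative_intros)
qed simp

lemma k_times_differentiable_mult:
  "k_times_differentiable k f \<Longrightarrow> k_times_differentiable k g \<Longrightarrow>
    k_times_differentiable k (\<lambda>x. f x * g x)"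
proof (induction k arbitrary: f g)
  case (Suc k)
  note fg_k_times = Suc.prems[THEN k_times_differentiable_SucD]
  from Suc obtain f' g' where derivs:
     "\<forall>x. (f has_field_derivative f' x) (at x)" "k_times_differentiable k f'"
     "\<forall>x. (g has_field_derivative g' x) (at x)" "k_times_differentiable k g'" by auto
  have "k_times_differentiable k (\<lambda>x. f' x * g x + g' x * f x)"
    using Suc.IH fg_k_times derivs by (intro k_times_differentiable_add) auto
  with derivs show ?case
    by (auto intro!: exI[of _ "\<lambda>x. f' x * g x + g' x * f x"] DERIV_mult)
qed simp

lemma k_times_differentiable_compose:
  "k_times_differentiable k f \<Longrightarrow> k_times_differentiable k g \<Longrightarrow>
    k_times_differentiable k (\<lambda>x. f (g x))"
proof (induction k arbitrary: f g)
  case (Suc k)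
  from Suc obtain f' g' where derivs:
     "\<forall>x. (f has_field_derivative f' x) (at x)" "k_times_differentiable k f'"
     "\<forall>x. (g has_field_derivative g' x) (at x)" "k_times_differentiable k g'" by auto
  have "k_times_differentiable k (\<lambda>x. f' (g x) * g' x)"
    using Suc.IH[OF derivs(2)] Suc.prems(2)[THEN k_times_differentiable_SucD] derivs
    by (intro k_times_differentiable_mult) auto
  with derivs show ?case
    unfolding k_times_differentiable.simps
    by (intro exI[of _ "\<lambda>x. f' (g x) * g' x"] conjI allI DERIV_chain2[of f]) auto
qed simp

lemma k_times_differentiable_inverse:
  "k_times_differentiable k f \<Longrightarrow> (\<And>x. f x \<noteq> 0) \<Longrightarrow>
    k_times_differentiable k (\<lambda>x. inverse (f x))"
proof (induction k arbitrary: f)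
  case (Suc k)
  from Suc obtain f' where derivs:
    "\<forall>x. (f has_field_derivative f' x) (at x)" "k_times_differentiable k f'" by auto
  have inverse_f: "k_times_differentiable k (\<lambda>x. inverse (f x))"
    using Suc.IH[OF k_times_differentiable_SucD[OF Suc.prems(1)]] Suc.prems by auto
  let ?d = "\<lambda>x. (-1) * (f' x * (inverse (f x) * inverse (f x)))"
  have "k_times_differentiable k ?d"
    by (intro k_times_differentiable_mult k_times_differentiable_const inverse_f derivs)
  with derivs Suc.prems(2) show ?case
    by (auto intro!: exI[of _ ?d] derivative_eq_intros)
qed simp

lemma infinitely_differentiable_const: "infinitely_differentiable (\<lambda>_. c)"
  and infinitely_differentiable_ident: "infinitely_differentiable (\<lambda>x. x)"
  by (simp_all add: infinitely_differentiable_def k_times_differentiable_ident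
      k_times_differentiable_const)

lemma infinitely_differentiable_add:
    "infinitely_differentiable f \<Longrightarrow> infinitely_differentiable g \<Longrightarrow>
      infinitely_differentiable (\<lambda>x. f x + g x)"
  and infinitely_differentiable_mult:
    "infinitely_differentiable f \<Longrightarrow> infinitely_differentiable g \<Longrightarrow>
      infinitely_differentiable (\<lambda>x. f x * g x)"
  and infinitely_differentiable_compose:
    "infinitely_differentiable f \<Longrightarrow> infinitely_differentiable g \<Longrightarrow>
      infinitely_differentiable (\<lambda>x. f (g x))"
  and infinitely_differentiable_inverse:
    "infinitely_differentiable f \<Longrightarrow> (\<And>x. f x \<noteq> 0) \<Longrightarrow>
      infinitely_differentiable (\<lambda>x. inverse (f x))"
  by (simp_all add: infinitely_differentiable_def k_times_differentiable_add
      k_times_differentiable_mult k_times_differentiable_compose k_times_differentiable_inverse)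

lemma infinitely_differentiable_diff:
  assumes "infinitely_differentiable f" "infinitely_differentiable g"
  shows "infinitely_differentiable (\<lambda>x. f x - g x)"
proof -
  have "infinitely_differentiable (\<lambda>x. f x + (-1) * g x)"
    by (intro infinitely_differentiable_add infinitely_differentiable_mult
        infinitely_differentiable_const assms)
  then show ?thesis by simp
qed

lemma infinitely_differentiable_divide:
  "infinitely_differentiable f \<Longrightarrow> infinitely_differentiable g \<Longrightarrow> (\<And>x. g x \<noteq> 0) \<Longrightarrow>
    infinitely_differentiable (\<lambda>x. f x / g x)"
  unfolding divide_inverse
  by (intro infinitely_differentiable_mult infinitely_differentiable_inverse)

lemma infinitely_differentiable_power:
  "infinitely_differentiable f \<Longrightarrow> infinitely_differentiable (\<lambda>x. f x ^ n)"
  by (induction n) (auto intro: infinitely_differentiable_const infinitely_differentiable_mult)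

lemmas infinitely_differentiable_intros =
  infinitely_differentiable_const infinitely_differentiable_ident infinitely_differentiable_add
  infinitely_differentiable_mult infinitely_differentiable_diff infinitely_differentiable_divide
  infinitely_differentiable_power

lemma infinitely_differentiable_has_derivative:
  assumes "infinitely_differentiable h"
  shows "(h has_field_derivative deriv h x) (at x)"
proof -
  have "k_times_differentiable (Suc 0) h"
    using assms unfolding infinitely_differentiable_def by blast
  then obtain h' where "\<forall>x. (h has_field_derivative h' x) (at x)" by auto
  then show ?thesis by (metis DERIV_imp_deriv)
qed

lemma infinitely_differentiable_deriv:
  assumes "infinitely_differentiable h"
  shows "infinitely_differentiable (deriv h)"
  unfolding infinitely_differentiable_def
proof
  fix k
  have "k_times_differentiable (Suc k) h"
    using assms unfolding infinitely_differentiable_def by blast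
  then obtain h' where h': "\<forall>x. (h has_field_derivative h' x) (at x)" "k_times_differentiable k h'"
    by auto
  then have "deriv h = h'" by (metis DERIV_imp_deriv ext)
  with h' show "k_times_differentiable k (deriv h)" by simp
qed

lemma infinitely_differentiable_iterated_deriv:
  "infinitely_differentiable h \<Longrightarrow> infinitely_differentiable ((deriv ^^ j) h)"
  by (induction j) (auto intro: infinitely_differentiable_deriv)

lemma infinitely_differentiable_continuous_on: "infinitely_differentiable h \<Longrightarrow> continuous_on S h"
  by (meson DERIV_isCont continuous_at_imp_continuous_on infinitely_differentiable_has_derivative)

lemma iterated_deriv_scale:
  assumes "infinitely_differentiable h"
  shows "(deriv ^^ j) (\<lambda>t. h (t / c)) = (\<lambda>t. (deriv ^^ j) h (t / c) / c ^ j)"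
proof (induction j)
  case (Suc j)
  have deriv_j: "((deriv ^^ j) h has_field_derivative (deriv ^^ Suc j) h y) (at y)" for y
    using infinitely_differentiable_has_derivative[OF
        infinitely_differentiable_iterated_deriv[OF assms]] by simp
  have "((\<lambda>t. (deriv ^^ j) h (t / c) / c ^ j) has_field_derivative
      (deriv ^^ Suc j) h (t / c) / c ^ Suc j) (at t)" for t
    by (rule DERIV_cong[OF DERIV_cdivide[OF
            DERIV_chain2[OF deriv_j DERIV_cdivide[OF DERIV_ident]]]]) simp
  then show ?case by (auto simp: Suc intro!: ext DERIV_imp_deriv)
qed simp

lemma iterated_deriv_eq_0_if_const_on_open:
  fixes h :: "'a::real_normed_field \<Rightarrow> 'a"
  assumes "open S" "\<And>t. t \<in> S \<Longrightarrow> h t = c" "j > 0" "t \<in> S"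
  shows "(deriv ^^ j) h t = 0"
proof -
  have "\<exists>d. \<forall>t\<in>S. (deriv ^^ i) h t = d \<and> (i > 0 \<longrightarrow> d = 0)" for i
  proof (induction i)
    case (Suc i)
    then obtain d where eq_d: "\<And>t. t \<in> S \<Longrightarrow> (deriv ^^ i) h t = d" by auto
    have "((deriv ^^ i) h has_field_derivative 0) (at t)" if "t \<in> S" for t
      by (rule has_field_derivative_transform_within_open[where S = S and f = "\<lambda>_. d"])
        (use eq_d assms that in auto)
    then show ?case by (auto intro!: exI[of _ 0] DERIV_imp_deriv)
  qed (use assms in auto)
  with assms show ?thesis by metis
qed

lemma iterated_deriv_power_factor:
  assumes "infinitely_differentiable h" "j \<le> k"
  shows "\<exists>q. infinitely_differentiable q \<and> (deriv ^^ j) (\<lambda>t. h t ^ k) = (\<lambda>t. h t ^ (k - j) * q t)"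
  using assms(2)
proof (induction j)
  case 0
  show ?case by (auto intro!: exI[of _ "\<lambda>_. 1"] infinitely_differentiable_const)
next
  case (Suc j)
  then obtain q where q: "infinitely_differentiable q"
    "(deriv ^^ j) (\<lambda>t. h t ^ k) = (\<lambda>t. h t ^ (k - j) * q t)" by auto
  obtain l where l_eq: "k - j = Suc l" "k - Suc j = l"
    using Suc.prems by (metis Suc_diff_Suc Suc_le_lessD)
  let ?q = "\<lambda>t. (1 + of_nat l) * (deriv h t * q t) + h t * deriv q t"
  have "((\<lambda>t. h t ^ Suc l * q t) has_field_derivative h t ^ l * ?q t) (at t)" for t
    using infinitely_differentiable_has_derivative[OF assms(1), of t]
      infinitely_differentiable_has_derivative[OF q(1), of t]
    by (auto intro!: derivative_eq_intros simp: algebra_simps) (cases l; simp)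
  then have "(deriv ^^ Suc j) (\<lambda>t. h t ^ k) = (\<lambda>t. h t ^ l * ?q t)"
    by (auto simp: q(2) l_eq intro!: ext DERIV_imp_deriv)
  moreover have "infinitely_differentiable ?q"
    by (intro infinitely_differentiable_intros infinitely_differentiable_deriv assms q)
  ultimately show ?case unfolding l_eq by (intro exI[of _ ?q]) auto
qed

text \<open>
  Each derivative removes only one of the \<open>k\<close> factors, and for \<open>0 \<le> h \<le> 1\<close> the remaining power
  \<open>h\<^sup>k\<^sup>-\<^sup>j\<close> is still at most \<open>(h\<^sup>k)\<^sup>r\<close> when \<open>k\<close> is large.
\<close>

lemma iterated_deriv_power_le_powr:
  fixes h :: "real \<Rightarrow> real"
  assumes smooth: "infinitely_differentiable h" and range: "\<And>t. h t \<in> {0..1}"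
    and support: "compact S" "\<And>t. t \<notin> S \<Longrightarrow> h t = 0"
    and exponent: "0 < r" "0 < k" "real j \<le> (1 - r) * real k"
  shows "\<exists>C\<ge>0. \<forall>t. \<bar>(deriv ^^ j) (\<lambda>t. h t ^ k) t\<bar> \<le> C * (h t ^ k) powr r"
proof -
  have rk_le: "r * real k \<le> real k - real j" using exponent(3) by (simp add: algebra_simps)
  moreover have "0 < r * real k" using exponent by simp
  ultimately have "j < k" by linarith
  obtain q where q: "infinitely_differentiable q"
    "(deriv ^^ j) (\<lambda>t. h t ^ k) = (\<lambda>t. h t ^ (k - j) * q t)"
    using \<open>j < k\<close> iterated_deriv_power_factor[OF smooth, of j k] by auto
  have "compact (q ` S)"
    by (intro compact_continuous_image infinitely_differentiable_continuous_on q support)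
  then obtain C where C_pos: "C > 0" and q_le: "\<And>t. t \<in> S \<Longrightarrow> \<bar>q t\<bar> \<le> C"
    by (metis bounded_pos compact_imp_bounded image_eqI real_norm_def)
  have "\<bar>h t ^ (k - j) * q t\<bar> \<le> C * (h t ^ k) powr r" for t
  proof (cases "h t = 0")
    case True
    then show ?thesis using \<open>j < k\<close> C_pos by (simp add: zero_power)
  next
    case False
    then have "t \<in> S" and h_t: "0 < h t" "h t \<le> 1" using support(2) range[of t] by auto
    have "h t ^ (k - j) = h t powr (real k - real j)"
      using h_t \<open>j < k\<close> by (simp flip: powr_realpow add: of_nat_diff)
    also have "\<dots> \<le> h t powr (r * real k)"
      using rk_le h_t by (intro powr_mono') auto
    also have "\<dots> = (h t ^ k) powr r"
      using h_t by (simp flip: powr_realpow add: powr_powr mult.commute)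
    finally have "h t ^ (k - j) * \<bar>q t\<bar> \<le> (h t ^ k) powr r * C"
      using q_le[OF \<open>t \<in> S\<close>] h_t by (intro mult_mono) auto
    then show ?thesis using h_t by (simp add: abs_mult mult.commute)
  qed
  with C_pos q(2) show ?thesis by (intro exI[of _ C]) auto
qed

subsection \<open>A smooth plateau function\<close>

definition flat_exp :: "nat \<Rightarrow> real \<Rightarrow> real" where
  "flat_exp n t = (if t > 0 then exp (- 1 / t) / t ^ n else 0)"

lemma flat_exp_pos: "t > 0 \<Longrightarrow> flat_exp n t > 0"
  and flat_exp_nonneg: "flat_exp n t \<ge> 0"
  and flat_exp_eq_0: "t \<le> 0 \<Longrightarrow> flat_exp n t = 0"
  by (auto simp: flat_exp_def)

lemma tendsto_flat_exp_div: "((\<lambda>t. flat_exp n t / t) \<longlongrightarrow> 0) (at 0)"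
proof (rule filterlim_split_at_real)
  have "((\<lambda>t. inverse t ^ Suc n / exp (inverse t)) \<longlongrightarrow> (0::real)) (at_right 0)"
    by (rule filterlim_compose[OF tendsto_power_div_exp_0 filterlim_inverse_at_top_right])
  moreover have "\<forall>\<^sub>F t in at_right 0. inverse t ^ Suc n / exp (inverse t) = flat_exp n t / t"
    using eventually_at_right_less
    by eventually_elim (simp add: flat_exp_def exp_minus field_simps)
  ultimately show "((\<lambda>t. flat_exp n t / t) \<longlongrightarrow> 0) (at_right 0)"
    by (rule Lim_transform_eventually)
  show "((\<lambda>t. flat_exp n t / t) \<longlongrightarrow> 0) (at_left 0)"
    by (rule Lim_transform_eventually[OF tendsto_const])
      (auto simp: flat_exp_def eventually_at_filter)
qed

lemma flat_exp_has_derivative: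
  "(flat_exp n has_real_derivative flat_exp (n + 2) t - real n * flat_exp (n + 1) t) (at t)"
proof (cases t "0::real" rule: linorder_cases)
  case less
  have "((\<lambda>_. 0) has_real_derivative 0) (at t)" by simp
  then have "(flat_exp n has_real_derivative 0) (at t)"
    by (rule has_field_derivative_transform_within_open[where S = "{..<0}"])
      (use less in \<open>auto simp: flat_exp_def\<close>)
  with less show ?thesis by (simp add: flat_exp_def)
next
  case equal
  show ?thesis using tendsto_flat_exp_div[of n] equal
    by (simp add: has_field_derivative_iff flat_exp_def[of _ 0])
next
  case greater
  have "((\<lambda>t. exp (- 1 / t) / t ^ n) has_real_derivative
      flat_exp (n + 2) t - real n * flat_exp (n + 1) t) (at t)"
    using greater
    by (auto intro!: derivative_eq_intros simp: flat_exp_def field_simps power2_eq_square)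
      (cases n; simp)
  then show ?thesis
    by (rule has_field_derivative_transform_within_open[where S = "{0<..}"])
      (use greater in \<open>auto simp: flat_exp_def\<close>)
qed

lemma infinitely_differentiable_flat_exp: "infinitely_differentiable (flat_exp n)"
  unfolding infinitely_differentiable_def
proof
  fix k show "k_times_differentiable k (flat_exp n)"
  proof (induction k arbitrary: n)
    case (Suc k)
    have "k_times_differentiable k (\<lambda>t. flat_exp (n + 2) t + (- real n) * flat_exp (n + 1) t)"
      by (intro k_times_differentiable_add k_times_differentiable_mult
          k_times_differentiable_const Suc)
    then have "k_times_differentiable k (\<lambda>t. flat_exp (n + 2) t - real n * flat_exp (n + 1) t)"
      by simp
    then show ?case
      unfolding k_times_differentiable.simps
      by (intro exI[of _ "\<lambda>t. flat_exp (n + 2) t - real n * flat_exp (n + 1) t"]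
          conjI allI flat_exp_has_derivative)
  qed simp
qed

definition plateau :: "real \<Rightarrow> real" where
  "plateau t = flat_exp 0 (1 - t\<^sup>2) / (flat_exp 0 (1 - t\<^sup>2) + flat_exp 0 (t\<^sup>2 - 1/4))"

lemma plateau_denominator_pos: "flat_exp 0 (1 - t\<^sup>2) + flat_exp 0 (t\<^sup>2 - 1/4) > 0"
proof (cases "t\<^sup>2 < 1")
  case True
  then show ?thesis by (intro add_pos_nonneg flat_exp_pos flat_exp_nonneg) simp
next
  case False
  then show ?thesis by (intro add_nonneg_pos flat_exp_pos flat_exp_nonneg) simp
qed

lemma infinitely_differentiable_plateau: "infinitely_differentiable plateau"
proof -
  have "infinitely_differentiable
      (\<lambda>t. flat_exp 0 (1 - t\<^sup>2) / (flat_exp 0 (1 - t\<^sup>2) + flat_exp 0 (t\<^sup>2 - 1/4)))"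
    by (intro infinitely_differentiable_intros
        infinitely_differentiable_compose[OF infinitely_differentiable_flat_exp]
        less_imp_neq[OF plateau_denominator_pos, symmetric])
  then show ?thesis by (simp add: plateau_def[abs_def])
qed

lemma plateau_range: "plateau t \<in> {0..1}"
  using plateau_denominator_pos[of t] flat_exp_nonneg[of 0 "1 - t\<^sup>2"]
    flat_exp_nonneg[of 0 "t\<^sup>2 - 1/4"]
  by (simp add: plateau_def)

lemma plateau_eq_1:
  assumes "\<bar>t\<bar> \<le> 1/2"
  shows "plateau t = 1"
proof -
  have "t\<^sup>2 \<le> (1/2)\<^sup>2" using assms by (metis abs_ge_zero power2_abs power_mono)
  then have "flat_exp 0 (t\<^sup>2 - 1/4) = 0" by (simp add: flat_exp_eq_0 power2_eq_square)
  then show ?thesis using plateau_denominator_pos[of t] by (simp add: plateau_def)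
qed

lemma plateau_eq_0:
  assumes "\<bar>t\<bar> \<ge> 1"
  shows "plateau t = 0"
proof -
  have "1 \<le> t\<^sup>2" using assms by (metis abs_le_square_iff abs_one power_one)
  then show ?thesis by (simp add: plateau_def flat_exp_eq_0)
qed

lemma iterated_deriv_plateau_power_eq_0:
  assumes "k > 0" and location: "\<bar>t\<bar> > 1 \<or> j \<noteq> 0 \<and> \<bar>t\<bar> < 1/2"
  shows "(deriv ^^ j) (\<lambda>t. plateau t ^ k) t = 0"
proof (cases "j = 0")
  case True
  then show ?thesis using assms by (simp add: plateau_eq_0)
next
  case False
  have "open {t::real. \<bar>t\<bar> > 1}" "open {t::real. \<bar>t\<bar> < 1/2}"
    by (intro open_Collect_less continuous_intros)+
  then show ?thesis
    using location False \<open>k > 0\<close>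
      iterated_deriv_eq_0_if_const_on_open[of "{t. \<bar>t\<bar> > 1}" "\<lambda>t. plateau t ^ k" 0 j t]
      iterated_deriv_eq_0_if_const_on_open[of "{t. \<bar>t\<bar> < 1/2}" "\<lambda>t. plateau t ^ k" 1 j t]
    by (auto simp: plateau_eq_0 plateau_eq_1)
qed

lemma ex_plateau_power_deriv_bound:
  fixes r :: real and m :: nat
  assumes r: "0 < r" "r < 1"
  obtains k C where "k > 0" "C \<ge> 0"
    "\<And>j t. j \<le> m \<Longrightarrow> \<bar>(deriv ^^ j) (\<lambda>t. plateau t ^ k) t\<bar> \<le> C * (plateau t ^ k) powr r"
proof -
  obtain k :: nat where "real k \<ge> real m / (1 - r) + 1" using real_arch_simple by blast
  moreover have "real m / (1 - r) \<ge> 0" using r by simp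
  ultimately have "k > 0" "real m / (1 - r) \<le> real k" by linarith+
  then have m_le: "real m \<le> (1 - r) * real k" using r by (simp add: field_simps)
  have "\<exists>C\<ge>0. \<forall>t. \<bar>(deriv ^^ j) (\<lambda>t. plateau t ^ k) t\<bar> \<le> C * (plateau t ^ k) powr r"
    if "j \<le> m" for j
    by (rule iterated_deriv_power_le_powr[where S = "{-1..1}"])
      (use r \<open>k > 0\<close> m_le that infinitely_differentiable_plateau plateau_range in
        \<open>auto intro!: plateau_eq_0\<close>)
  then obtain c where c_nonneg: "\<And>j. j \<le> m \<Longrightarrow> c j \<ge> 0"
    and deriv_le: "\<And>j t. j \<le> m \<Longrightarrow>
      \<bar>(deriv ^^ j) (\<lambda>t. plateau t ^ k) t\<bar> \<le> c j * (plateau t ^ k) powr r"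
    by metis
  have c_le_sum: "c j \<le> (\<Sum>j\<le>m. c j)" if "j \<le> m" for j
    using c_nonneg that by (intro member_le_sum) auto
  show thesis
  proof
    show "(\<Sum>j\<le>m. c j) \<ge> 0" using c_nonneg by (intro sum_nonneg) auto
    show "\<bar>(deriv ^^ j) (\<lambda>t. plateau t ^ k) t\<bar> \<le> (\<Sum>j\<le>m. c j) * (plateau t ^ k) powr r"
      if "j \<le> m" for j t
      using deriv_le[OF that] c_le_sum[OF that] by (meson mult_right_mono order_trans powr_ge_zero)
  qed fact
qed

subsection \<open>Partial derivatives of products of one-variable functions\<close>

lemma pderiv_dir_prod:
  fixes h :: "'n::finite \<Rightarrow> real \<Rightarrow> real"
  assumes "\<And>j. infinitely_differentiable (h j)"
  shows "pderiv_dir i (\<lambda>x. \<Prod>j\<in>UNIV. h j (x $ j)) =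
    (\<lambda>x. \<Prod>j\<in>UNIV. (if j = i then deriv (h i) else h j) (x $ j))"
proof
  fix x :: "real^'n"
  let ?P = "\<Prod>j\<in>UNIV - {i}. h j (x $ j)"
  have "(\<Prod>j\<in>UNIV. h j ((x + t *\<^sub>R axis i 1) $ j)) = h i (x $ i + t) * ?P" for t
    by (subst prod.remove[of _ i]) (auto simp: axis_def intro!: prod.cong)
  moreover have "((\<lambda>t. h i (x $ i + t) * ?P) has_real_derivative deriv (h i) (x $ i) * ?P) (at 0)"
    by (rule DERIV_cmult_right,
        rule DERIV_chain2[THEN DERIV_cong, OF infinitely_differentiable_has_derivative[OF assms]])
      (auto intro!: derivative_eq_intros)
  moreover have "(\<Prod>j\<in>UNIV. (if j = i then deriv (h i) else h j) (x $ j)) = deriv (h i) (x $ i) * ?P"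
    by (subst prod.remove[of _ i]) (auto intro!: prod.cong)
  ultimately show "pderiv_dir i (\<lambda>x. \<Prod>j\<in>UNIV. h j (x $ j)) x =
    (\<Prod>j\<in>UNIV. (if j = i then deriv (h i) else h j) (x $ j))"
    by (simp add: pderiv_dir_def DERIV_imp_deriv)
qed

lemma pderiv_list_prod:
  fixes h :: "'n::finite \<Rightarrow> real \<Rightarrow> real"
  assumes "\<And>j. infinitely_differentiable (h j)"
  shows "pderiv_list is (\<lambda>x. \<Prod>j\<in>UNIV. h j (x $ j)) =
    (\<lambda>x. \<Prod>j\<in>UNIV. (deriv ^^ count_list is j) (h j) (x $ j))"
proof (induction "is")
  case (Cons i "is")
  have "pderiv_dir i (\<lambda>x. \<Prod>j\<in>UNIV. (deriv ^^ count_list is j) (h j) (x $ j)) =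
    (\<lambda>x. \<Prod>j\<in>UNIV. (if j = i then deriv ((deriv ^^ count_list is i) (h i))
      else (deriv ^^ count_list is j) (h j)) (x $ j))"
    by (rule pderiv_dir_prod) (intro infinitely_differentiable_iterated_deriv assms)
  also have "\<dots> = (\<lambda>x. \<Prod>j\<in>UNIV. (deriv ^^ count_list (i # is) j) (h j) (x $ j))"
    by (auto intro!: ext prod.cong)
  finally show ?case by (simp only: pderiv_list.simps Cons)
qed simp

lemma ex_list_with_counts:
  fixes \<alpha> :: "'n::finite \<Rightarrow> nat"
  shows "\<exists>is. \<forall>i. count_list is i = \<alpha> i"
proof -
  obtain "is" where "mset is = Abs_multiset \<alpha>" using ex_mset by blast
  then have "count_list is i = \<alpha> i" for i by (simp flip: count_mset)
  then show ?thesis by blast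
qed

lemma pderiv_mi_prod:
  fixes h :: "'n::finite \<Rightarrow> real \<Rightarrow> real"
  assumes "\<And>j. infinitely_differentiable (h j)"
  shows "pderiv_mi \<alpha> (\<lambda>x. \<Prod>j\<in>UNIV. h j (x $ j)) =
    (\<lambda>x. \<Prod>j\<in>UNIV. (deriv ^^ \<alpha> j) (h j) (x $ j))"
  using someI_ex[OF ex_list_with_counts[of \<alpha>]]
  by (simp add: pderiv_mi_def pderiv_list_prod[OF assms])

lemma differentiable_prod_infinitely_differentiable:
  fixes h :: "'n::finite \<Rightarrow> real \<Rightarrow> real"
  assumes "\<And>j. infinitely_differentiable (h j)"
  shows "(\<lambda>x::real^'n. \<Prod>j\<in>UNIV. h j (x $ j)) differentiable (at x)"
proof -
  have "((\<lambda>x::real^'n. h j (x $ j)) has_derivative (\<lambda>y. y $ j * deriv (h j) (x $ j))) (at x)" for j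
    by (rule DERIV_compose_FDERIV[OF infinitely_differentiable_has_derivative[OF assms]])
      (intro bounded_linear.has_derivative[OF bounded_linear_vec_nth] has_derivative_ident)
  from has_derivative_prod[of UNIV "\<lambda>j x. h j (x $ j)", OF this] show ?thesis
    unfolding differentiable_def by blast
qed

lemma smooth_fun_prod:
  fixes h :: "'n::finite \<Rightarrow> real \<Rightarrow> real"
  assumes "\<And>j. infinitely_differentiable (h j)"
  shows "smooth_fun (\<lambda>x. \<Prod>j\<in>UNIV. h j (x $ j))"
  unfolding smooth_fun_def pderiv_list_prod[OF assms]
  by (auto intro!: differentiable_at_imp_differentiable_on
      differentiable_prod_infinitely_differentiable infinitely_differentiable_iterated_deriv assms)

lemma mi_component_le_order: "\<alpha> i \<le> mi_order \<alpha>"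
  unfolding mi_order_def by (rule member_le_sum) auto

lemma mi_order_eq_0_iff: "mi_order \<alpha> = 0 \<longleftrightarrow> (\<forall>i. \<alpha> i = 0)"
  by (simp add: mi_order_def)

lemma finite_mi_order_le: "finite {\<alpha>::'n::finite \<Rightarrow> nat. mi_order \<alpha> \<le> m}"
proof (rule finite_subset)
  show "{\<alpha>::'n \<Rightarrow> nat. mi_order \<alpha> \<le> m} \<subseteq> PiE UNIV (\<lambda>_. {..m})"
    using mi_component_le_order by (auto intro: order_trans)
qed (auto intro: finite_PiE)

subsection \<open>Smooth cutoff functions of boxes\<close>

definition box_cutoff :: "nat \<Rightarrow> ('n::finite \<Rightarrow> real) \<Rightarrow> real^'n \<Rightarrow> real" where
  "box_cutoff k \<rho> x = (\<Prod>i\<in>UNIV. plateau (x $ i / \<rho> i) ^ k)"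

lemma box_cutoff_nonneg: "0 \<le> box_cutoff k \<rho> x"
  and box_cutoff_le_1: "box_cutoff k \<rho> x \<le> 1"
  unfolding box_cutoff_def using plateau_range
  by (auto intro!: prod_nonneg prod_le_1 power_le_one)

lemma box_cutoff_eq_1:
  assumes "\<And>i. \<rho> i > 0" "\<And>i. \<bar>x $ i\<bar> \<le> \<rho> i / 2"
  shows "box_cutoff k \<rho> x = 1"
  unfolding box_cutoff_def
proof (intro prod.neutral ballI)
  fix i
  have "\<bar>x $ i / \<rho> i\<bar> \<le> 1/2" using assms[of i] by (simp add: field_simps)
  then show "plateau (x $ i / \<rho> i) ^ k = 1" by (simp add: plateau_eq_1)
qed

lemma eventually_box_cutoff_eq_1:
  assumes "\<And>i. filterlim (F i) at_top G"
  shows "\<forall>\<^sub>F R in G. box_cutoff k (\<lambda>i. F i R) x = 1"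
proof -
  have "\<forall>\<^sub>F R in G. \<forall>i. 2 * \<bar>x $ i\<bar> + 1 \<le> F i R"
    using assms by (intro eventually_all_finite) (auto simp: filterlim_at_top)
  then show ?thesis
  proof eventually_elim
    case (elim R)
    then have "F i R > 0" "\<bar>x $ i\<bar> \<le> F i R / 2" for i using elim[rule_format, of i] by linarith+
    then show ?case by (rule box_cutoff_eq_1)
  qed
qed

lemma infinitely_differentiable_plateau_scale_power:
  "infinitely_differentiable (\<lambda>t. plateau (t / c) ^ k)"
  unfolding divide_inverse
  by (intro infinitely_differentiable_intros
      infinitely_differentiable_compose[OF infinitely_differentiable_plateau])

lemma test_fun_box_cutoff:
  assumes "\<And>i. \<rho> i > 0" "k > 0"
  shows "test_fun (box_cutoff k \<rho>)"
  unfolding test_fun_def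
proof (intro conjI exI allI impI)
  show "smooth_fun (box_cutoff k \<rho>)"
    unfolding box_cutoff_def[abs_def]
    by (intro smooth_fun_prod infinitely_differentiable_plateau_scale_power)
  show "compact (cbox (\<chi> i. - \<rho> i) (\<chi> i. \<rho> i))" by simp
  fix x assume "x \<notin> cbox (\<chi> i. - \<rho> i) (\<chi> i. \<rho> i)"
  then obtain i where "\<not> (- \<rho> i \<le> x $ i \<and> x $ i \<le> \<rho> i)" by (auto simp: mem_box_cart)
  then have "\<bar>x $ i / \<rho> i\<bar> \<ge> 1" using assms(1)[of i] by (simp add: field_simps) linarith
  then have "plateau (x $ i / \<rho> i) ^ k = 0" using \<open>k > 0\<close> by (simp add: plateau_eq_0)
  then show "box_cutoff k \<rho> x = 0" unfolding box_cutoff_def by (auto intro: prod_zero)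
qed

lemma pderiv_mi_box_cutoff:
  "pderiv_mi \<alpha> (box_cutoff k \<rho>) x =
    (\<Prod>i\<in>UNIV. (deriv ^^ \<alpha> i) (\<lambda>t. plateau t ^ k) (x $ i / \<rho> i) / \<rho> i ^ \<alpha> i)"
proof -
  have "infinitely_differentiable (\<lambda>t. plateau t ^ k)"
    by (intro infinitely_differentiable_power infinitely_differentiable_plateau)
  from iterated_deriv_scale[OF this] show ?thesis
    unfolding box_cutoff_def[abs_def]
    by (simp add: pderiv_mi_prod[OF infinitely_differentiable_plateau_scale_power])
qed

lemma pderiv_mi_box_cutoff_eq_0:
  assumes F_pos: "\<And>i. F i R > 0" and "k > 0" and outside: "x \<notin> Q_set F \<alpha> R"
  shows "pderiv_mi \<alpha> (box_cutoff k (\<lambda>i. F i R)) x = 0"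
proof -
  from outside obtain i where "\<bar>x $ i\<bar> > F i R \<or> \<alpha> i \<noteq> 0 \<and> \<bar>x $ i\<bar> < F i R / 2"
    by (auto simp: Q_set_def not_le)
  then have "\<bar>x $ i / F i R\<bar> > 1 \<or> \<alpha> i \<noteq> 0 \<and> \<bar>x $ i / F i R\<bar> < 1/2"
    using F_pos[of i] by (auto simp: field_simps)
  from iterated_deriv_plateau_power_eq_0[OF \<open>k > 0\<close> this] show ?thesis
    unfolding pderiv_mi_box_cutoff by (auto intro!: prod_zero)
qed

lemma pderiv_mi_box_cutoff_le_powr:
  fixes F :: "'n::finite \<Rightarrow> real \<Rightarrow> real"
  assumes F_pos: "\<And>i. F i R > 0" and order: "mi_order \<alpha> \<le> m"
    and deriv_le: "\<And>j t. j \<le> m \<Longrightarrow>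
      \<bar>(deriv ^^ j) (\<lambda>t. plateau t ^ k) t\<bar> \<le> C * (plateau t ^ k) powr r"
  shows "\<bar>pderiv_mi \<alpha> (box_cutoff k (\<lambda>i. F i R)) x\<bar> \<le>
    C ^ CARD('n) * H_fun F \<alpha> R * box_cutoff k (\<lambda>i. F i R) x powr r"
proof -
  let ?\<eta> = "\<lambda>t. plateau t ^ k"
  have "\<bar>pderiv_mi \<alpha> (box_cutoff k (\<lambda>i. F i R)) x\<bar> \<le>
      (\<Prod>i\<in>UNIV. C * F i R powr - real (\<alpha> i) * ?\<eta> (x $ i / F i R) powr r)"
    unfolding pderiv_mi_box_cutoff abs_prod
  proof (intro prod_mono conjI)
    fix i
    have "\<alpha> i \<le> m" using mi_component_le_order order by (rule order_trans)
    then have "\<bar>(deriv ^^ \<alpha> i) ?\<eta> (x $ i / F i R)\<bar> / F i R ^ \<alpha> i \<le>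
        C * ?\<eta> (x $ i / F i R) powr r / F i R ^ \<alpha> i"
      using F_pos[of i] by (intro divide_right_mono deriv_le) auto
    then show "\<bar>(deriv ^^ \<alpha> i) ?\<eta> (x $ i / F i R) / F i R ^ \<alpha> i\<bar> \<le>
        C * F i R powr - real (\<alpha> i) * ?\<eta> (x $ i / F i R) powr r"
      using F_pos[of i] by (simp add: powr_minus powr_realpow field_simps)
  qed auto
  also have "\<dots> = C ^ CARD('n) * H_fun F \<alpha> R * box_cutoff k (\<lambda>i. F i R) x powr r"
    by (simp add: prod.distrib prod_powr_distrib H_fun_def box_cutoff_def)
  finally show ?thesis .
qed

lemma ex_box_cutoff_pderiv_bound:
  fixes m :: nat and r :: real
  assumes "0 < r" "r < 1"
  obtains k C where "k > 0" "C \<ge> 0"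
    "\<And>(F :: 'n::finite \<Rightarrow> real \<Rightarrow> real) R \<alpha> x. (\<And>i. F i R > 0) \<Longrightarrow> mi_order \<alpha> \<le> m \<Longrightarrow>
      \<bar>pderiv_mi \<alpha> (box_cutoff k (\<lambda>i. F i R)) x\<bar> \<le>
        C * H_fun F \<alpha> R * box_cutoff k (\<lambda>i. F i R) x powr r * indicator (Q_set F \<alpha> R) x"
proof -
  obtain k C where "k > 0" "C \<ge> 0" and deriv_le:
    "\<And>j t. j \<le> m \<Longrightarrow> \<bar>(deriv ^^ j) (\<lambda>t. plateau t ^ k) t\<bar> \<le> C * (plateau t ^ k) powr r"
    using ex_plateau_power_deriv_bound[OF assms] by metis
  show thesis
  proof
    show "\<bar>pderiv_mi \<alpha> (box_cutoff k (\<lambda>i. F i R)) x\<bar> \<le> C ^ CARD('n) * H_fun F \<alpha> R *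
        box_cutoff k (\<lambda>i. F i R) x powr r * indicator (Q_set F \<alpha> R) x"
      if F_pos: "\<And>i. F i R > 0" and order: "mi_order \<alpha> \<le> m"
      for F :: "'n \<Rightarrow> real \<Rightarrow> real" and R \<alpha> x
    proof (cases "x \<in> Q_set F \<alpha> R")
      case True
      have "\<bar>pderiv_mi \<alpha> (box_cutoff k (\<lambda>i. F i R)) x\<bar> \<le>
          C ^ CARD('n) * H_fun F \<alpha> R * box_cutoff k (\<lambda>i. F i R) x powr r"
        by (rule pderiv_mi_box_cutoff_le_powr[where F = F]) (fact F_pos order deriv_le)+
      with True show ?thesis by simp
    next
      case False
      have "pderiv_mi \<alpha> (box_cutoff k (\<lambda>i. F i R)) x = 0"
        by (rule pderiv_mi_box_cutoff_eq_0[where F = F]) (fact F_pos \<open>k > 0\<close> False)+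
      with False show ?thesis by simp
    qed
    show "C ^ CARD('n) \<ge> 0" using \<open>C \<ge> 0\<close> by simp
  qed fact
qed

lemma H_fun_pos:
  assumes "\<And>i. F i R > 0"
  shows "H_fun F \<alpha> R > 0"
  unfolding H_fun_def using assms by (intro prod_pos) (simp add: less_imp_neq[symmetric])

lemma Q_set_in_sets_lebesgue: "Q_set F \<alpha> R \<in> sets lebesgue"
proof -
  have "closed (Q_set F \<alpha> R)"
    unfolding Q_set_def
    by (intro closed_Collect_all closed_Collect_conj closed_Collect_imp closed_Collect_le
        continuous_intros) auto
  then show ?thesis by (simp add: borel_closed sets_completionI_sets)
qed

lemma eventually_not_in_Q_set:
  assumes "filterlim (F i) at_top G" "\<alpha> i \<noteq> 0"
  shows "\<forall>\<^sub>F R in G. x \<notin> Q_set F \<alpha> R"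
proof -
  have "\<forall>\<^sub>F R in G. 2 * \<bar>x $ i\<bar> < F i R" using assms(1) by (auto simp: filterlim_at_top_dense)
  then show ?thesis
  proof eventually_elim
    case (elim R)
    then have "\<not> F i R / 2 \<le> \<bar>x $ i\<bar>" by simp
    with assms(2) show ?case by (auto simp: Q_set_def)
  qed
qed

subsection \<open>Locally integrable functions and test functions\<close>

lemma continuous_on_pderiv_list: "test_fun \<phi> \<Longrightarrow> continuous_on UNIV (pderiv_list is \<phi>)"
  unfolding test_fun_def smooth_fun_def by (blast intro: differentiable_imp_continuous_on)

lemma borel_measurable_test_fun: "test_fun \<phi> \<Longrightarrow> \<phi> \<in> borel_measurable lebesgue"
  using continuous_on_pderiv_list[of \<phi> "[]"]
  by (simp add: borel_measurable_continuous_onI measurable_completion)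

lemma borel_measurable_pderiv_mi: "test_fun \<phi> \<Longrightarrow> pderiv_mi \<alpha> \<phi> \<in> borel_measurable lebesgue"
  unfolding pderiv_mi_def
  by (simp add: borel_measurable_continuous_onI continuous_on_pderiv_list measurable_completion)

lemma L1_loc_integrable_mult_test_fun:
  assumes v: "L1_loc v" and \<phi>: "test_fun \<phi>"
  shows "integrable lebesgue (\<lambda>x. v x * \<phi> x)"
proof -
  obtain K where "compact K" and outside_K: "\<And>x. x \<notin> K \<Longrightarrow> \<phi> x = 0"
    using \<phi> unfolding test_fun_def by blast
  have "compact (\<phi> ` K)"
    using \<open>compact K\<close> continuous_on_subset[OF continuous_on_pderiv_list[OF \<phi>, of "[]"]]
    by (intro compact_continuous_image) auto
  then obtain C where \<phi>_le: "\<And>x. x \<in> K \<Longrightarrow> \<bar>\<phi> x\<bar> \<le> C"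
    by (metis bounded_iff compact_imp_bounded image_eqI real_norm_def)
  have "integrable lebesgue (\<lambda>x. C * (indicator K x *\<^sub>R v x))"
    using v \<open>compact K\<close> unfolding L1_loc_def set_integrable_def
    by (intro integrable_mult_right) blast
  then show ?thesis
  proof (rule Bochner_Integration.integrable_bound)
    have "\<bar>v x * \<phi> x\<bar> \<le> \<bar>C * (indicator K x *\<^sub>R v x)\<bar>" for x
    proof (cases "x \<in> K")
      case True
      then have "\<bar>\<phi> x\<bar> \<le> \<bar>C\<bar>" using \<phi>_le by force
      then show ?thesis using True by (simp add: abs_mult mult.commute mult_right_mono)
    qed (simp add: outside_K)
    then show "AE x in lebesgue. norm (v x * \<phi> x) \<le> norm (C * (indicator K x *\<^sub>R v x))" by simp
  qed (use v borel_measurable_test_fun[OF \<phi>] in \<open>auto simp: L1_loc_def\<close>)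
qed

subsection \<open>Hoelder's inequality\<close>

lemma integrable_mult_conjugate_exponents:
  fixes f g :: "'a \<Rightarrow> real" and p q :: real
  assumes pq: "p > 1" "q > 1" "1 / p + 1 / q = 1"
    and meas: "f \<in> borel_measurable M" "g \<in> borel_measurable M"
    and int: "integrable M (\<lambda>x. \<bar>f x\<bar> powr p)" "integrable M (\<lambda>x. \<bar>g x\<bar> powr q)"
  shows "integrable M (\<lambda>x. f x * g x)"
proof (rule Bochner_Integration.integrable_bound)
  show "integrable M (\<lambda>x. \<bar>f x\<bar> powr p / p + \<bar>g x\<bar> powr q / q)"
    by (intro Bochner_Integration.integrable_add integrable_divide int)
  have "\<bar>f x * g x\<bar> \<le> \<bar>\<bar>f x\<bar> powr p / p + \<bar>g x\<bar> powr q / q\<bar>" for x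
    using Youngs_inequality[OF pq, of "\<bar>f x\<bar>" "\<bar>g x\<bar>"] by (simp add: abs_mult)
  then show "AE x in M. norm (f x * g x) \<le> norm (\<bar>f x\<bar> powr p / p + \<bar>g x\<bar> powr q / q)" by simp
qed (use meas in measurable)

lemma Holder_inequality:
  fixes f g :: "'a \<Rightarrow> real" and p q :: real
  assumes pq: "p > 1" "q > 1" "1 / p + 1 / q = 1"
    and meas: "f \<in> borel_measurable M" "g \<in> borel_measurable M"
    and int: "integrable M (\<lambda>x. \<bar>f x\<bar> powr p)" "integrable M (\<lambda>x. \<bar>g x\<bar> powr q)"
  shows "(\<integral>x. \<bar>f x * g x\<bar> \<partial>M) \<le>
    (\<integral>x. \<bar>f x\<bar> powr p \<partial>M) powr (1 / p) * (\<integral>x. \<bar>g x\<bar> powr q \<partial>M) powr (1 / q)"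
    (is "_ \<le> ?A powr (1 / p) * ?B powr (1 / q)")
proof (cases "?A = 0 \<or> ?B = 0")
  case True
  then have "(AE x in M. f x = 0) \<or> (AE x in M. g x = 0)"
    using integral_nonneg_eq_0_iff_AE[OF int(1)] integral_nonneg_eq_0_iff_AE[OF int(2)] by auto
  then have "AE x in M. \<bar>f x * g x\<bar> = 0" by (auto elim: eventually_mono)
  then have "(\<integral>x. \<bar>f x * g x\<bar> \<partial>M) = 0" by (rule integral_eq_zero_AE)
  then show ?thesis by simp
next
  case False
  moreover have "?A \<ge> 0" "?B \<ge> 0" by simp_all
  ultimately have AB_pos: "?A > 0" "?B > 0" by linarith+
  define a b where "a = ?A powr (1 / p)" and "b = ?B powr (1 / q)"
  have ab: "a > 0" "b > 0" "a powr p = ?A" "b powr q = ?B"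
    using AB_pos pq by (simp_all add: a_def b_def powr_powr)
  have "\<bar>f x * g x\<bar> / (a * b) \<le> \<bar>f x\<bar> powr p / ?A / p + \<bar>g x\<bar> powr q / ?B / q" for x
    using Youngs_inequality[OF pq, of "\<bar>f x\<bar> / a" "\<bar>g x\<bar> / b"] ab
    by (simp add: abs_mult powr_divide)
  then have "(\<integral>x. \<bar>f x * g x\<bar> / (a * b) \<partial>M) \<le>
      (\<integral>x. \<bar>f x\<bar> powr p / ?A / p + \<bar>g x\<bar> powr q / ?B / q \<partial>M)"
    using integrable_mult_conjugate_exponents[OF pq meas int] int
    by (intro integral_mono integrable_divide integrable_abs Bochner_Integration.integrable_add)
  also have "\<dots> = 1" using int pq AB_pos by simp
  finally show ?thesis using ab by (simp add: a_def b_def field_simps)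
qed

lemma Holder_inequality_weighted:
  fixes f g w :: "'a \<Rightarrow> real" and p q :: real
  assumes pq: "p > 1" "q > 1" "1 / p + 1 / q = 1"
    and meas [measurable]:
      "f \<in> borel_measurable M" "g \<in> borel_measurable M" "w \<in> borel_measurable M"
    and w_pos: "AE x in M. w x > 0"
    and int: "integrable M (\<lambda>x. w x * \<bar>f x\<bar> powr p)"
      "integrable M (\<lambda>x. \<bar>g x\<bar> powr q * w x powr (- (q - 1)))"
  shows "integrable M (\<lambda>x. f x * g x)"
    and "(\<integral>x. \<bar>f x * g x\<bar> \<partial>M) \<le> (\<integral>x. w x * \<bar>f x\<bar> powr p \<partial>M) powr (1 / p) *
      (\<integral>x. \<bar>g x\<bar> powr q * w x powr (- (q - 1)) \<partial>M) powr (1 / q)"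
proof -
  let ?f = "\<lambda>x. w x powr (1 / p) * f x" and ?g = "\<lambda>x. w x powr (- (1 / p)) * g x"
  have "q / p = q - 1" using pq by (simp add: field_simps)
  then have f_powr: "AE x in M. \<bar>?f x\<bar> powr p = w x * \<bar>f x\<bar> powr p"
    and g_powr: "AE x in M. \<bar>?g x\<bar> powr q = \<bar>g x\<bar> powr q * w x powr (- (q - 1))"
    using w_pos pq by (auto elim!: eventually_mono simp: abs_mult powr_mult powr_powr)
  have fg_eq: "AE x in M. ?f x * ?g x = f x * g x"
    using w_pos by eventually_elim (simp add: powr_minus)
  have powr_integrable:
    "integrable M (\<lambda>x. \<bar>?f x\<bar> powr p)" "integrable M (\<lambda>x. \<bar>?g x\<bar> powr q)"
    using int integrable_cong_AE[OF _ _ f_powr] integrable_cong_AE[OF _ _ g_powr] by simp_all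
  show "integrable M (\<lambda>x. f x * g x)"
    using integrable_mult_conjugate_exponents[OF pq _ _ powr_integrable]
      integrable_cong_AE[OF _ _ fg_eq] by simp
  have abs_fg_eq: "AE x in M. \<bar>?f x * ?g x\<bar> = \<bar>f x * g x\<bar>"
    using fg_eq by eventually_elim (simp only:)
  show "(\<integral>x. \<bar>f x * g x\<bar> \<partial>M) \<le> (\<integral>x. w x * \<bar>f x\<bar> powr p \<partial>M) powr (1 / p) *
      (\<integral>x. \<bar>g x\<bar> powr q * w x powr (- (q - 1)) \<partial>M) powr (1 / q)"
    using Holder_inequality[OF pq _ _ powr_integrable] integral_cong_AE[OF _ _ abs_fg_eq]
      integral_cong_AE[OF _ _ f_powr] integral_cong_AE[OF _ _ g_powr] by simp
qed

lemma integral_le_if_abs_le_mult: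
  fixes f h :: "'a \<Rightarrow> real" and K :: real
  assumes h_int: "integrable M h" and f_meas: "f \<in> borel_measurable M"
    and abs_le: "\<And>x. \<bar>f x\<bar> \<le> K * \<bar>h x\<bar>"
  shows "integrable M f" and "(\<integral>x. f x \<partial>M) \<le> K * (\<integral>x. \<bar>h x\<bar> \<partial>M)"
proof -
  have bound_int: "integrable M (\<lambda>x. K * \<bar>h x\<bar>)"
    using h_int by (intro integrable_mult_right integrable_abs)
  then show f_int: "integrable M f"
    by (rule Bochner_Integration.integrable_bound)
      (use f_meas abs_le in \<open>auto intro!: AE_I2 order_trans[OF _ abs_ge_self]\<close>)
  have "(\<integral>x. f x \<partial>M) \<le> (\<integral>x. K * \<bar>h x\<bar> \<partial>M)"
    using abs_le by (intro integral_mono f_int bound_int) (metis abs_ge_self order_trans)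
  then show "(\<integral>x. f x \<partial>M) \<le> K * (\<integral>x. \<bar>h x\<bar> \<partial>M)" by simp
qed

lemma Holder_inequality_localized:
  fixes u a d \<phi> w :: "'a \<Rightarrow> real" and p q K :: real
  assumes pq: "p > 1" "q > 1" "1 / p + 1 / q = 1"
    and meas [measurable]: "u \<in> borel_measurable M" "a \<in> borel_measurable M"
      "d \<in> borel_measurable M" "\<phi> \<in> borel_measurable M" "w \<in> borel_measurable M" "Q \<in> sets M"
    and w_pos: "AE x in M. w x > 0" and \<phi>_nonneg: "\<And>x. 0 \<le> \<phi> x"
    and K_nonneg: "0 \<le> K"
    and d_le: "\<And>x. \<bar>d x\<bar> \<le> K * \<phi> x powr (1 / p) * indicator Q x"
    and int_u: "integrable M (\<lambda>x. w x * \<bar>u x\<bar> powr p * \<phi> x * indicator Q x)"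
    and int_a: "integrable M (\<lambda>x. \<bar>a x\<bar> powr q * w x powr (- (q - 1)) * indicator Q x)"
  shows "integrable M (\<lambda>x. u x * (a x * d x))"
    and "(\<integral>x. u x * (a x * d x) \<partial>M) \<le>
      K * (\<integral>x. w x * \<bar>u x\<bar> powr p * \<phi> x * indicator Q x \<partial>M) powr (1 / p) *
      (\<integral>x. \<bar>a x\<bar> powr q * w x powr (- (q - 1)) * indicator Q x \<partial>M) powr (1 / q)"
      (is "_ \<le> K * ?U powr (1 / p) * ?V powr (1 / q)")
proof -
  let ?f = "\<lambda>x. u x * \<phi> x powr (1 / p) * indicator Q x" and ?g = "\<lambda>x. a x * indicator Q x"
  have f_powr: "w x * \<bar>?f x\<bar> powr p = w x * \<bar>u x\<bar> powr p * \<phi> x * indicator Q x" for x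
    using \<phi>_nonneg[of x] pq by (simp add: indicator_def abs_mult powr_mult powr_powr)
  have g_powr: "\<bar>?g x\<bar> powr q * w x powr (- (q - 1)) =
      \<bar>a x\<bar> powr q * w x powr (- (q - 1)) * indicator Q x" for x
    by (simp add: indicator_def)
  have meas_fg: "?f \<in> borel_measurable M" "?g \<in> borel_measurable M" by measurable
  note Holder = Holder_inequality_weighted[OF pq meas_fg meas(5) w_pos, unfolded f_powr g_powr,
      OF int_u int_a]
  have abs_le: "\<bar>u x * (a x * d x)\<bar> \<le> K * \<bar>?f x * ?g x\<bar>" for x
  proof -
    have "\<bar>u x * (a x * d x)\<bar> \<le> \<bar>u x * a x\<bar> * (K * \<phi> x powr (1 / p) * indicator Q x)"
      unfolding mult.assoc[symmetric] abs_mult[of "u x * a x"]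
      using mult_left_mono[OF d_le[of x], of "\<bar>u x * a x\<bar>"] by (simp add: mult.assoc)
    also have "\<dots> = K * \<bar>?f x * ?g x\<bar>" by (simp add: indicator_def abs_mult)
    finally show ?thesis .
  qed
  have uad_meas: "(\<lambda>x. u x * (a x * d x)) \<in> borel_measurable M" by measurable
  note uad_facts = Holder(1) uad_meas abs_le
  show "integrable M (\<lambda>x. u x * (a x * d x))" by (rule integral_le_if_abs_le_mult(1)[OF uad_facts])
  have "(\<integral>x. u x * (a x * d x) \<partial>M) \<le> K * (\<integral>x. \<bar>?f x * ?g x\<bar> \<partial>M)"
    by (rule integral_le_if_abs_le_mult(2)[OF uad_facts])
  also have "\<dots> \<le> K * (?U powr (1 / p) * ?V powr (1 / q))"
    using Holder(2) K_nonneg by (rule mult_left_mono)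
  finally show "(\<integral>x. u x * (a x * d x) \<partial>M) \<le> K * ?U powr (1 / p) * ?V powr (1 / q)"
    by (simp only: mult.assoc)
qed

subsection \<open>Absorption and passage to the limit\<close>

lemma le_mult_powr_imp_le:
  fixes x K r :: real
  assumes "0 \<le> x" "r < 1" "x \<le> K * x powr r"
  shows "x \<le> K powr (1 / (1 - r))"
proof (cases "x = 0")
  case False
  then have "x > 0" using assms(1) by simp
  then have "x powr (1 - r) \<le> K" using assms(3) by (simp add: powr_diff field_simps)
  then have "(x powr (1 - r)) powr (1 / (1 - r)) \<le> K powr (1 / (1 - r))"
    using assms(2) by (intro powr_mono2) auto
  then show ?thesis using assms(2) \<open>x > 0\<close> by (simp add: powr_powr)
qed simp

lemma integrable_Fatou:
  fixes f :: "nat \<Rightarrow> 'a \<Rightarrow> real"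
  assumes int: "\<And>n. integrable M (f n)" and nonneg: "\<And>n. AE x in M. 0 \<le> f n x"
    and meas: "v \<in> borel_measurable M" and lim: "AE x in M. (\<lambda>n. f n x) \<longlonglongrightarrow> v x"
    and bound: "\<forall>\<^sub>F n in sequentially. (\<integral>x. f n x \<partial>M) \<le> C"
  shows "integrable M v"
proof (rule integrableI_nonneg[OF meas])
  have "AE x in M. \<forall>n. 0 \<le> f n x" using nonneg by (simp add: AE_all_countable)
  then show "AE x in M. 0 \<le> v x"
    using lim by eventually_elim (auto intro: LIMSEQ_le_const)
  have "AE x in M. ennreal (v x) = liminf (\<lambda>n. ennreal (f n x))"
    using lim by eventually_elim (auto intro!: lim_imp_Liminf[symmetric] tendsto_ennrealI)
  then have "(\<integral>\<^sup>+ x. ennreal (v x) \<partial>M) = (\<integral>\<^sup>+ x. liminf (\<lambda>n. ennreal (f n x)) \<partial>M)"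
    by (rule nn_integral_cong_AE)
  also have "\<dots> \<le> liminf (\<lambda>n. \<integral>\<^sup>+ x. ennreal (f n x) \<partial>M)"
    using int by (intro nn_integral_liminf) (auto intro: borel_measurable_integrable)
  also have "\<dots> = liminf (\<lambda>n. ennreal (\<integral>x. f n x \<partial>M))"
    using int nonneg by (simp add: nn_integral_eq_integral)
  also have "\<dots> \<le> limsup (\<lambda>n. ennreal (\<integral>x. f n x \<partial>M))" by (intro Liminf_le_Limsup) simp
  also have "\<dots> \<le> ennreal C"
    using bound by (intro Limsup_bounded) (auto elim!: eventually_mono intro: ennreal_leI)
  finally show "(\<integral>\<^sup>+ x. ennreal (v x) \<partial>M) < \<infinity>"
    by (metis ennreal_less_top infinity_ennreal_def order_le_less_trans)
qed

lemma integrable_limit_if_integral_le_powr: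
  fixes f :: "nat \<Rightarrow> 'a \<Rightarrow> real"
  assumes "r < 1" and f_int: "\<And>n. integrable M (f n)"
    and f_nonneg: "\<And>n. AE x in M. 0 \<le> f n x" and v_meas: "v \<in> borel_measurable M"
    and f_lim: "AE x in M. (\<lambda>n. f n x) \<longlonglongrightarrow> v x"
    and bound: "\<forall>\<^sub>F n in sequentially. (\<integral>x. f n x \<partial>M) \<le> K * (\<integral>x. f n x \<partial>M) powr r"
  shows "integrable M v"
proof (rule integrable_Fatou[OF f_int f_nonneg v_meas f_lim])
  show "\<forall>\<^sub>F n in sequentially. (\<integral>x. f n x \<partial>M) \<le> K powr (1 / (1 - r))"
    using bound
    by eventually_elim (intro le_mult_powr_imp_le integral_nonneg_AE f_nonneg \<open>r < 1\<close>)
qed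

lemma AE_eq_0_if_integral_le_sum_powr:
  fixes f :: "nat \<Rightarrow> 'a \<Rightarrow> real" and g :: "'i \<Rightarrow> nat \<Rightarrow> 'a \<Rightarrow> real"
  assumes r: "0 < r" "r < 1"
    and v_meas: "v \<in> borel_measurable M"
    and f_int: "\<And>n. integrable M (f n)" and g_int: "\<And>i n. i \<in> I \<Longrightarrow> integrable M (g i n)"
    and f_bounds: "\<And>n. AE x in M. 0 \<le> f n x \<and> f n x \<le> v x"
    and g_bounds: "\<And>i n. i \<in> I \<Longrightarrow> AE x in M. 0 \<le> g i n x \<and> g i n x \<le> f n x"
    and f_lim: "AE x in M. (\<lambda>n. f n x) \<longlonglongrightarrow> v x"
    and g_lim: "\<And>i. i \<in> I \<Longrightarrow> AE x in M. (\<lambda>n. g i n x) \<longlonglongrightarrow> 0"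
    and bound: "\<forall>\<^sub>F n in sequentially.
      (\<integral>x. f n x \<partial>M) \<le> (\<Sum>i\<in>I. K i * (\<integral>x. g i n x \<partial>M) powr r)"
  shows "AE x in M. v x = 0"
proof -
  have f_nonneg: "AE x in M. 0 \<le> f n x" for n using f_bounds[of n] by eventually_elim simp
  have v_nonneg: "AE x in M. 0 \<le> v x" using f_bounds[of 0] by eventually_elim simp
  have g_integral: "0 \<le> (\<integral>x. g i n x \<partial>M)" "(\<integral>x. g i n x \<partial>M) \<le> (\<integral>x. f n x \<partial>M)" if "i \<in> I" for i n
    using g_bounds[OF that, of n] f_int[of n] g_int[OF that, of n]
    by (auto intro!: integral_nonneg_AE integral_mono_AE elim!: eventually_mono)
  have "\<forall>\<^sub>F n in sequentially. (\<integral>x. f n x \<partial>M) \<le> (\<Sum>i\<in>I. \<bar>K i\<bar>) * (\<integral>x. f n x \<partial>M) powr r"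
    using bound
  proof eventually_elim
    case (elim n)
    also have "(\<Sum>i\<in>I. K i * (\<integral>x. g i n x \<partial>M) powr r) \<le> (\<Sum>i\<in>I. \<bar>K i\<bar> * (\<integral>x. f n x \<partial>M) powr r)"
      using g_integral r by (intro sum_mono mult_mono powr_mono2) auto
    finally show ?case by (simp add: sum_distrib_right)
  qed
  then have v_int: "integrable M v"
    by (rule integrable_limit_if_integral_le_powr[OF r(2) f_int f_nonneg v_meas f_lim])
  have "AE x in M. norm (f n x) \<le> v x" for n
    using f_bounds[of n] by eventually_elim simp
  then have "(\<lambda>n. \<integral>x. f n x \<partial>M) \<longlonglongrightarrow> (\<integral>x. v x \<partial>M)"
    using v_int f_int f_lim by (intro integral_dominated_convergence[where w = v]) auto
  moreover have "(\<lambda>n. \<Sum>i\<in>I. K i * (\<integral>x. g i n x \<partial>M) powr r) \<longlonglongrightarrow> (\<Sum>i\<in>I. K i * 0 powr r)"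
  proof (intro tendsto_sum tendsto_mult_left tendsto_powr2 tendsto_const)
    fix i assume i: "i \<in> I"
    have "AE x in M. norm (g i n x) \<le> v x" for n
      using g_bounds[OF i, of n] f_bounds[of n] by eventually_elim simp
    then have "(\<lambda>n. \<integral>x. g i n x \<partial>M) \<longlonglongrightarrow> (\<integral>x. 0 \<partial>M)"
      using v_int g_int[OF i] g_lim[OF i]
      by (intro integral_dominated_convergence[where w = v]) auto
    then show "(\<lambda>n. \<integral>x. g i n x \<partial>M) \<longlonglongrightarrow> 0" by simp
  qed (use g_integral r in auto)
  ultimately have "(\<integral>x. v x \<partial>M) \<le> (\<Sum>i\<in>I. K i * 0 powr r)"
    using bound by (intro tendsto_le[OF sequentially_bot])
  then have "(\<integral>x. v x \<partial>M) = 0" using integral_nonneg_AE[OF v_nonneg] by simp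
  then show ?thesis using integral_nonneg_eq_0_iff_AE[OF v_int v_nonneg] by simp
qed

lemma AE_eq_0_if_integral_cutoff_le:
  fixes v :: "real^'n::finite \<Rightarrow> real" and Q :: "'i \<Rightarrow> nat \<Rightarrow> (real^'n) set"
  assumes r: "0 < r" "r < 1"
    and v: "L1_loc v" "AE x in lebesgue. 0 \<le> v x"
    and \<phi>: "\<And>n. test_fun (\<phi> n)" "\<And>n x. 0 \<le> \<phi> n x" "\<And>n x. \<phi> n x \<le> 1"
    and \<phi>_exhausts: "\<And>x. \<forall>\<^sub>F n in sequentially. \<phi> n x = 1"
    and Q: "\<And>i n. Q i n \<in> sets lebesgue"
    and Q_escapes: "\<And>i x. i \<in> I \<Longrightarrow> \<forall>\<^sub>F n in sequentially. x \<notin> Q i n"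
    and bound: "\<forall>\<^sub>F n in sequentially. (\<integral>x. v x * \<phi> n x \<partial>lebesgue) \<le>
      (\<Sum>i\<in>I. K i * (\<integral>x. v x * \<phi> n x * indicator (Q i n) x \<partial>lebesgue) powr r)"
  shows "AE x in lebesgue. v x = 0"
proof (rule AE_eq_0_if_integral_le_sum_powr[OF r _ _ _ _ _ _ _ bound])
  show v_\<phi>: "integrable lebesgue (\<lambda>x. v x * \<phi> n x)" for n
    by (intro L1_loc_integrable_mult_test_fun v \<phi>)
  show "integrable lebesgue (\<lambda>x. v x * \<phi> n x * indicator (Q i n) x)" for i n
    by (intro integrable_real_mult_indicator Q v_\<phi>)
  show "AE x in lebesgue. 0 \<le> v x * \<phi> n x \<and> v x * \<phi> n x \<le> v x" for n
    using v(2) by eventually_elim (simp add: \<phi> mult_left_le)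
  show "AE x in lebesgue. 0 \<le> v x * \<phi> n x * indicator (Q i n) x \<and>
      v x * \<phi> n x * indicator (Q i n) x \<le> v x * \<phi> n x" for i n
    using v(2) by eventually_elim (simp add: \<phi> indicator_def)
  have "\<forall>\<^sub>F n in sequentially. v x * \<phi> n x = v x" for x
    using \<phi>_exhausts[of x] by eventually_elim simp
  then show "AE x in lebesgue. (\<lambda>n. v x * \<phi> n x) \<longlonglongrightarrow> v x"
    by (intro AE_I2 tendsto_eventually)
  have "\<forall>\<^sub>F n in sequentially. v x * \<phi> n x * indicator (Q i n) x = 0" if "i \<in> I" for i x
    using Q_escapes[OF that, of x] by eventually_elim simp
  then show "AE x in lebesgue. (\<lambda>n. v x * \<phi> n x * indicator (Q i n) x) \<longlonglongrightarrow> 0" if "i \<in> I" for i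
    using that by (intro AE_I2 tendsto_eventually)
qed (use v(1) in \<open>simp add: L1_loc_def\<close>)

subsection \<open>The growth condition\<close>

lemma
  assumes [measurable]: "a \<in> borel_measurable lebesgue" "f \<in> borel_measurable lebesgue"
      "g \<in> borel_measurable lebesgue"
    and finite: "G_fun F q a g f \<alpha> R < \<infinity>"
  shows integrable_G_fun: "integrable lebesgue
      (\<lambda>x. \<bar>a x\<bar> powr q * (g x * f x) powr (- (q - 1)) * indicator (Q_set F \<alpha> R) x)"
    and integral_G_fun: "(\<integral>x. \<bar>a x\<bar> powr q * (g x * f x) powr (- (q - 1)) *
      indicator (Q_set F \<alpha> R) x \<partial>lebesgue) = enn2real (G_fun F q a g f \<alpha> R)"
proof -
  let ?w = "\<lambda>x. \<bar>a x\<bar> powr q * (g x * f x) powr (- (q - 1)) * indicator (Q_set F \<alpha> R) x"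
  note Q_set_in_sets_lebesgue [measurable]
  have G: "(\<integral>\<^sup>+ x. ennreal (?w x) \<partial>lebesgue) = G_fun F q a g f \<alpha> R"
    unfolding G_fun_def by (intro nn_integral_cong) (auto simp: indicator_def)
  show "integrable lebesgue ?w"
    by (rule integrableI_nonneg) (use finite G in auto)
  show "(\<integral>x. ?w x \<partial>lebesgue) = enn2real (G_fun F q a g f \<alpha> R)"
    unfolding G[symmetric] by (rule integral_eq_nn_integral) auto
qed

lemma eventually_bounded_if_Limsup_finite:
  fixes H :: "'a \<Rightarrow> real" and G :: "'a \<Rightarrow> ennreal"
  assumes H_pos: "\<forall>\<^sub>F R in X. H R > 0"
    and Limsup_finite: "Limsup X (\<lambda>R. ennreal (H R) * enn_powr (G R) s) < \<infinity>"
  shows "\<exists>B. \<forall>\<^sub>F R in X. G R < \<infinity> \<and> H R * enn2real (G R) powr s \<le> B"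
proof -
  obtain z where Limsup_less: "Limsup X (\<lambda>R. ennreal (H R) * enn_powr (G R) s) < z" and "z < \<infinity>"
    using dense[OF Limsup_finite] by blast
  then obtain B where z_eq: "z = ennreal B" "B \<ge> 0" by (cases z) auto
  from Limsup_lessD[OF Limsup_less] H_pos
  have "\<forall>\<^sub>F R in X. G R < \<infinity> \<and> H R * enn2real (G R) powr s \<le> B"
  proof eventually_elim
    case (elim R)
    then have finite: "G R \<noteq> \<infinity>" by (auto simp: enn_powr_def ennreal_mult_top)
    then have "H R * enn2real (G R) powr s < B"
      using elim z_eq by (simp add: enn_powr_def ennreal_mult[symmetric] ennreal_less_iff)
    with finite show ?case by (simp add: less_top)
  qed
  then show ?thesis ..
qed

subsection \<open>Estimates for global solutions\<close>

locale global_solution =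
  fixes p :: real and m :: nat and A :: "('n::finite \<Rightarrow> nat) set"
    and a :: "('n \<Rightarrow> nat) \<Rightarrow> real^'n \<Rightarrow> real" and f g u :: "real^'n \<Rightarrow> real"
  assumes p_gt_1: "p > 1"
    and A_order: "\<And>\<alpha>. \<alpha> \<in> A \<Longrightarrow> 1 \<le> mi_order \<alpha> \<and> mi_order \<alpha> \<le> m"
    and measurable_data: "f \<in> borel_measurable lebesgue" "g \<in> borel_measurable lebesgue"
      "u \<in> borel_measurable lebesgue" "\<And>\<alpha>. \<alpha> \<in> A \<Longrightarrow> a \<alpha> \<in> borel_measurable lebesgue"
    and f_pos: "AE x in lebesgue. f x > 0" and g_pos: "AE x in lebesgue. g x > 0"
    and L1_loc_fgu: "L1_loc (\<lambda>x. f x * g x * \<bar>u x\<bar> powr p)"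
    and weak_equation: "\<And>\<phi>. test_fun \<phi> \<Longrightarrow>
      (\<integral>x. f x * g x * \<bar>u x\<bar> powr p * \<phi> x \<partial>lebesgue) =
      (\<integral>x. u x * (\<Sum>\<alpha>\<in>A. a \<alpha> x * pderiv_mi \<alpha> \<phi> x) \<partial>lebesgue)"
begin

abbreviation conj_exponent :: real where
  "conj_exponent \<equiv> p / (p - 1)"

definition source :: "real^'n \<Rightarrow> real" where
  "source x = f x * g x * \<bar>u x\<bar> powr p"

definition source_integral :: "(real^'n \<Rightarrow> real) \<Rightarrow> (real^'n) set \<Rightarrow> real" where
  "source_integral \<phi> S = (\<integral>x. source x * \<phi> x * indicator S x \<partial>lebesgue)"

text \<open>
  As \<open>enn2real \<infinity> = 0\<close>, a bound on this factor is only useful together with finiteness of \<open>G_fun\<close>.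
\<close>

definition growth_factor :: "('n \<Rightarrow> real \<Rightarrow> real) \<Rightarrow> ('n \<Rightarrow> nat) \<Rightarrow> real \<Rightarrow> real" where
  "growth_factor F \<alpha> R =
    H_fun F \<alpha> R * enn2real (G_fun F conj_exponent (a \<alpha>) g f \<alpha> R) powr (1 / conj_exponent)"

lemma L1_loc_source: "L1_loc source"
  using L1_loc_fgu by (simp add: source_def[abs_def])

lemma source_nonneg: "AE x in lebesgue. 0 \<le> source x"
  using f_pos g_pos by eventually_elim (simp add: source_def)

lemma finite_A: "finite A"
  by (rule finite_subset[OF _ finite_mi_order_le[of m]]) (use A_order in auto)

lemma integral_mult_pderiv_le:
  assumes test: "test_fun \<phi>" and \<phi>_nonneg: "\<And>x. 0 \<le> \<phi> x" and C_nonneg: "0 \<le> C"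
    and \<alpha>: "\<alpha> \<in> A" and G_finite: "G_fun F conj_exponent (a \<alpha>) g f \<alpha> R < \<infinity>"
    and deriv_le: "\<And>x. \<bar>pderiv_mi \<alpha> \<phi> x\<bar> \<le>
      C * H_fun F \<alpha> R * \<phi> x powr (1 / p) * indicator (Q_set F \<alpha> R) x"
  shows "integrable lebesgue (\<lambda>x. u x * (a \<alpha> x * pderiv_mi \<alpha> \<phi> x))"
    and "(\<integral>x. u x * (a \<alpha> x * pderiv_mi \<alpha> \<phi> x) \<partial>lebesgue) \<le>
      C * source_integral \<phi> (Q_set F \<alpha> R) powr (1 / p) * growth_factor F \<alpha> R"
proof -
  have exponents: "p > 1" "conj_exponent > 1" "1 / p + 1 / conj_exponent = 1"
    using p_gt_1 by (auto simp: field_simps)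
  have weight_pos: "AE x in lebesgue. g x * f x > 0"
    using f_pos g_pos by eventually_elim simp
  have weight_measurable: "(\<lambda>x. g x * f x) \<in> borel_measurable lebesgue"
    using measurable_data by (intro borel_measurable_times)
  have source_eq: "g x * f x * \<bar>u x\<bar> powr p = source x" for x by (simp add: source_def)
  have CH_nonneg: "0 \<le> C * H_fun F \<alpha> R"
    using C_nonneg by (simp add: H_fun_def prod_nonneg)
  note a_measurable = measurable_data(4)[OF \<alpha>]
  note G_fun_facts = a_measurable measurable_data(1,2) G_finite
  note source_integrable = integrable_real_mult_indicator[OF Q_set_in_sets_lebesgue
      L1_loc_integrable_mult_test_fun[OF L1_loc_source test]]
  note Holder = Holder_inequality_localized[OF exponents measurable_data(3) a_measurable
      borel_measurable_pderiv_mi[OF test] borel_measurable_test_fun[OF test] weight_measurable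
      Q_set_in_sets_lebesgue weight_pos \<phi>_nonneg CH_nonneg deriv_le, unfolded source_eq,
      OF source_integrable integrable_G_fun[OF G_fun_facts]]
  show "integrable lebesgue (\<lambda>x. u x * (a \<alpha> x * pderiv_mi \<alpha> \<phi> x))" by (fact Holder(1))
  show "(\<integral>x. u x * (a \<alpha> x * pderiv_mi \<alpha> \<phi> x) \<partial>lebesgue) \<le>
      C * source_integral \<phi> (Q_set F \<alpha> R) powr (1 / p) * growth_factor F \<alpha> R"
    using Holder(2) unfolding integral_G_fun[OF G_fun_facts]
    by (simp add: source_integral_def growth_factor_def mult_ac)
qed

lemma source_integral_le:
  assumes test: "test_fun \<phi>" "\<And>x. 0 \<le> \<phi> x" "0 \<le> C"
    and G_finite: "\<And>\<alpha>. \<alpha> \<in> A \<Longrightarrow> G_fun F conj_exponent (a \<alpha>) g f \<alpha> R < \<infinity>"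
    and deriv_le: "\<And>\<alpha> x. \<alpha> \<in> A \<Longrightarrow>
      \<bar>pderiv_mi \<alpha> \<phi> x\<bar> \<le> C * H_fun F \<alpha> R * \<phi> x powr (1 / p) * indicator (Q_set F \<alpha> R) x"
  shows "source_integral \<phi> UNIV \<le>
    (\<Sum>\<alpha>\<in>A. C * source_integral \<phi> (Q_set F \<alpha> R) powr (1 / p) * growth_factor F \<alpha> R)"
proof -
  have "source_integral \<phi> UNIV = (\<integral>x. (\<Sum>\<alpha>\<in>A. u x * (a \<alpha> x * pderiv_mi \<alpha> \<phi> x)) \<partial>lebesgue)"
    using weak_equation[OF test(1)] by (simp add: source_integral_def source_def sum_distrib_left)
  also have "\<dots> = (\<Sum>\<alpha>\<in>A. \<integral>x. u x * (a \<alpha> x * pderiv_mi \<alpha> \<phi> x) \<partial>lebesgue)"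
    using integral_mult_pderiv_le(1)[OF test _ G_finite deriv_le]
    by (intro Bochner_Integration.integral_sum)
  also have "\<dots> \<le>
      (\<Sum>\<alpha>\<in>A. C * source_integral \<phi> (Q_set F \<alpha> R) powr (1 / p) * growth_factor F \<alpha> R)"
    using integral_mult_pderiv_le(2)[OF test _ G_finite deriv_le] by (intro sum_mono)
  finally show ?thesis .
qed

lemma eventually_growth_factor_le:
  assumes F_pos: "\<And>i R. R > 0 \<Longrightarrow> F i R > 0"
    and growth: "\<And>\<alpha>. \<alpha> \<in> A \<Longrightarrow> Limsup at_top (\<lambda>R. ennreal (H_fun F \<alpha> R) *
      enn_powr (G_fun F conj_exponent (a \<alpha>) g f \<alpha> R) (1 / conj_exponent)) < \<infinity>"
  obtains B where "\<forall>\<^sub>F R in at_top. \<forall>\<alpha>\<in>A.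
    G_fun F conj_exponent (a \<alpha>) g f \<alpha> R < \<infinity> \<and> growth_factor F \<alpha> R \<le> B \<alpha>"
proof -
  have "\<forall>\<^sub>F R in at_top. H_fun F \<alpha> R > 0" for \<alpha>
    using eventually_gt_at_top[of 0] by eventually_elim (intro H_fun_pos F_pos)
  then have "\<forall>\<alpha>\<in>A. \<exists>B. \<forall>\<^sub>F R in at_top.
      G_fun F conj_exponent (a \<alpha>) g f \<alpha> R < \<infinity> \<and> growth_factor F \<alpha> R \<le> B"
    unfolding growth_factor_def by (intro ballI eventually_bounded_if_Limsup_finite growth)
  from bchoice[OF this] obtain B where "\<forall>\<alpha>\<in>A. \<forall>\<^sub>F R in at_top.
      G_fun F conj_exponent (a \<alpha>) g f \<alpha> R < \<infinity> \<and> growth_factor F \<alpha> R \<le> B \<alpha>" ..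
  then show thesis by (intro that eventually_ball_finite finite_A)
qed

lemma eventually_source_integral_box_cutoff_le:
  assumes F_pos: "\<And>i R. R > 0 \<Longrightarrow> F i R > 0"
    and growth: "\<And>\<alpha>. \<alpha> \<in> A \<Longrightarrow> Limsup at_top (\<lambda>R. ennreal (H_fun F \<alpha> R) *
      enn_powr (G_fun F conj_exponent (a \<alpha>) g f \<alpha> R) (1 / conj_exponent)) < \<infinity>"
  obtains k K where "k > 0"
    "\<forall>\<^sub>F R in at_top. source_integral (box_cutoff k (\<lambda>i. F i R)) UNIV \<le>
      (\<Sum>\<alpha>\<in>A. K \<alpha> * source_integral (box_cutoff k (\<lambda>i. F i R)) (Q_set F \<alpha> R) powr (1 / p))"
proof -
  obtain B where eventually_le_B: "\<forall>\<^sub>F R in at_top. \<forall>\<alpha>\<in>A.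
      G_fun F conj_exponent (a \<alpha>) g f \<alpha> R < \<infinity> \<and> growth_factor F \<alpha> R \<le> B \<alpha>"
    using eventually_growth_factor_le[OF F_pos growth] .
  have "0 < 1 / p" "1 / p < 1" using p_gt_1 by auto
  from ex_box_cutoff_pderiv_bound[OF this, where ?'n = 'n and m = m]
  obtain k C where "k > 0" "C \<ge> 0" and deriv_le: "\<And>(F :: 'n \<Rightarrow> real \<Rightarrow> real) R \<alpha> x.
      (\<And>i. F i R > 0) \<Longrightarrow> mi_order \<alpha> \<le> m \<Longrightarrow> \<bar>pderiv_mi \<alpha> (box_cutoff k (\<lambda>i. F i R)) x\<bar> \<le>
        C * H_fun F \<alpha> R * box_cutoff k (\<lambda>i. F i R) x powr (1 / p) * indicator (Q_set F \<alpha> R) x"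
    by metis
  from eventually_gt_at_top[of 0] eventually_le_B
  have "\<forall>\<^sub>F R in at_top. source_integral (box_cutoff k (\<lambda>i. F i R)) UNIV \<le> (\<Sum>\<alpha>\<in>A. C * B \<alpha> *
      source_integral (box_cutoff k (\<lambda>i. F i R)) (Q_set F \<alpha> R) powr (1 / p))"
  proof eventually_elim
    case (elim R)
    let ?\<phi> = "box_cutoff k (\<lambda>i. F i R)"
    have "F i R > 0" for i using elim(1) by (rule F_pos)
    then have "source_integral ?\<phi> UNIV \<le>
        (\<Sum>\<alpha>\<in>A. C * source_integral ?\<phi> (Q_set F \<alpha> R) powr (1 / p) * growth_factor F \<alpha> R)"
      using elim(2) A_order \<open>k > 0\<close> \<open>C \<ge> 0\<close>
      by (intro source_integral_le test_fun_box_cutoff box_cutoff_nonneg deriv_le) auto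
    also have "\<dots> \<le> (\<Sum>\<alpha>\<in>A. C * source_integral ?\<phi> (Q_set F \<alpha> R) powr (1 / p) * B \<alpha>)"
      using elim(2) \<open>C \<ge> 0\<close> by (intro sum_mono mult_left_mono) auto
    finally show ?case by (simp add: mult_ac)
  qed
  with \<open>k > 0\<close> show thesis by (rule that)
qed

lemma source_eq_0_AE:
  assumes F_pos: "\<And>i R. R > 0 \<Longrightarrow> F i R > 0" and F_lim: "\<And>i. filterlim (F i) at_top at_top"
    and growth: "\<And>\<alpha>. \<alpha> \<in> A \<Longrightarrow> Limsup at_top (\<lambda>R. ennreal (H_fun F \<alpha> R) *
      enn_powr (G_fun F conj_exponent (a \<alpha>) g f \<alpha> R) (1 / conj_exponent)) < \<infinity>"
  shows "AE x in lebesgue. source x = 0"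
proof -
  obtain k K where "k > 0" and source_le:
    "\<forall>\<^sub>F R in at_top. source_integral (box_cutoff k (\<lambda>i. F i R)) UNIV \<le>
      (\<Sum>\<alpha>\<in>A. K \<alpha> * source_integral (box_cutoff k (\<lambda>i. F i R)) (Q_set F \<alpha> R) powr (1 / p))"
    using eventually_source_integral_box_cutoff_le[OF F_pos growth] .
  define R where "R n = real (Suc n)" for n
  have R_lim: "filterlim R at_top sequentially"
    unfolding R_def[abs_def]
    by (rule filterlim_compose[OF filterlim_real_sequentially filterlim_Suc])
  show ?thesis
  proof (rule AE_eq_0_if_integral_cutoff_le[where r = "1 / p" and I = A and
        \<phi> = "\<lambda>n. box_cutoff k (\<lambda>i. F i (R n))" and Q = "\<lambda>\<alpha> n. Q_set F \<alpha> (R n)"])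
    show "test_fun (box_cutoff k (\<lambda>i. F i (R n)))" for n
      by (intro test_fun_box_cutoff F_pos \<open>k > 0\<close>) (simp add: R_def)
    show "\<forall>\<^sub>F n in sequentially. box_cutoff k (\<lambda>i. F i (R n)) x = 1" for x
      by (intro eventually_box_cutoff_eq_1 filterlim_compose[OF F_lim R_lim])
    show "\<forall>\<^sub>F n in sequentially. x \<notin> Q_set F \<alpha> (R n)" if \<alpha>: "\<alpha> \<in> A" for \<alpha> x
    proof -
      have "mi_order \<alpha> \<noteq> 0" using A_order[OF \<alpha>] by simp
      then obtain i where "\<alpha> i \<noteq> 0" by (auto simp: mi_order_eq_0_iff)
      then have "\<forall>\<^sub>F R in at_top. x \<notin> Q_set F \<alpha> R" by (intro eventually_not_in_Q_set F_lim)
      then show ?thesis using R_lim by (rule eventually_compose_filterlim)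
    qed
  qed (use p_gt_1 L1_loc_source source_nonneg box_cutoff_nonneg box_cutoff_le_1
      Q_set_in_sets_lebesgue eventually_compose_filterlim[OF source_le R_lim] in
      \<open>auto simp: source_integral_def\<close>)
qed

end

theorem theorem2p15:
  fixes p :: real and m :: nat
    and b :: "('n::finite \<Rightarrow> nat) \<Rightarrow> real^'n \<Rightarrow> real"
    and a :: "('n \<Rightarrow> nat) \<Rightarrow> real^'n \<Rightarrow> real"
    and f g u :: "real^'n \<Rightarrow> real"
    and F :: "'n \<Rightarrow> real \<Rightarrow> real"
  defines "p' \<equiv> p / (p - 1)"
  defines "A \<equiv> {\<alpha>::'n \<Rightarrow> nat. 1 \<le> mi_order \<alpha> \<and> mi_order \<alpha> \<le> m}"
  assumes p_gt1: "p > 1"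
    (* L(x,\<nabla>) = \<Sum>_{|\<alpha>|\<le>m} b_\<alpha>(x) \<partial>^\<alpha>, D = g L, D^* = \<Sum>_{1\<le>|\<alpha>|\<le>m} a_\<alpha> \<partial>^\<alpha> is its formal adjoint *)
    and f_Linf: "Linf_loc f" and f_pos: "AE x in lebesgue. f x > 0"
    and g_meas: "g \<in> borel_measurable lebesgue" and g_pos: "AE x in lebesgue. g x > 0"
    and a_Linf: "\<And>\<alpha>. \<alpha> \<in> A \<Longrightarrow> Linf_loc (a \<alpha>)"
    and adjoint: "\<And>\<psi> \<phi>. test_fun \<psi> \<Longrightarrow> test_fun \<phi> \<Longrightarrow>
        integrable lebesgue (\<lambda>x. \<phi> x * (g x * (\<Sum>\<alpha>\<in>{\<alpha>. mi_order \<alpha> \<le> m}. b \<alpha> x * pderiv_mi \<alpha> \<psi> x)))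
      \<and> (\<integral>x. \<phi> x * (g x * (\<Sum>\<alpha>\<in>{\<alpha>. mi_order \<alpha> \<le> m}. b \<alpha> x * pderiv_mi \<alpha> \<psi> x)) \<partial>lebesgue)
        = (\<integral>x. \<psi> x * (\<Sum>\<alpha>\<in>A. a \<alpha> x * pderiv_mi \<alpha> \<phi> x) \<partial>lebesgue)"
    and u_L1: "L1_loc u"
    and fgu_L1: "L1_loc (\<lambda>x. f x * g x * \<bar>u x\<bar> powr p)"
    and solution: "\<And>\<phi>. test_fun \<phi> \<Longrightarrow>
        (\<integral>x. f x * g x * \<bar>u x\<bar> powr p * \<phi> x \<partial>lebesgue)
        = (\<integral>x. u x * (\<Sum>\<alpha>\<in>A. a \<alpha> x * pderiv_mi \<alpha> \<phi> x) \<partial>lebesgue)"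
    and F_mono: "\<And>i. strict_mono_on {0<..} (F i)"
    and F_cont: "\<And>i. continuous_on {0<..} (F i)"
    and F_pos: "\<And>i R. R > 0 \<Longrightarrow> F i R > 0"
    and F_lim: "\<And>i. filterlim (F i) at_top at_top"
    and growth: "\<And>\<alpha>. \<alpha> \<in> A \<Longrightarrow>
        Limsup at_top (\<lambda>R. ennreal (H_fun F \<alpha> R) * enn_powr (G_fun F p' (a \<alpha>) g f \<alpha> R) (1 / p')) < \<infinity>"
  shows "AE x in lebesgue. u x = 0"
proof -
  interpret global_solution p m A a f g u
  proof
    show "1 \<le> mi_order \<alpha> \<and> mi_order \<alpha> \<le> m" if "\<alpha> \<in> A" for \<alpha> using that by (simp add: A_def)
    show "f \<in> borel_measurable lebesgue" using f_Linf by (simp add: Linf_loc_def)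
    show "u \<in> borel_measurable lebesgue" using u_L1 by (simp add: L1_loc_def)
    show "a \<alpha> \<in> borel_measurable lebesgue" if "\<alpha> \<in> A" for \<alpha>
      using a_Linf[OF that] by (simp add: Linf_loc_def)
  qed (fact p_gt1 g_meas f_pos g_pos fgu_L1 solution)+
  have "AE x in lebesgue. source x = 0"
    by (rule source_eq_0_AE[OF F_pos F_lim growth[unfolded p'_def]])
  then show ?thesis
    using f_pos g_pos by eventually_elim (auto simp: source_def)
qed

end
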